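(* For every $n,k\in\mathbb N$ with $n\ge 2k$, $$(k-1)n\le ex_<(n,\neg\text{Nest-}\mathcal M_k)\le ex_<(n,\neg\text{Nest*-}\mathcal M_k)\le (k-1)n+\binom{k-1}{2}.$$
   Context: An ordered graph on $n$ vertices is a graph with vertex set $[n]$ with its natural order. An ordered graph $G$ contains a copy of an ordered graph $H$ if there is an injective, order-preserving map $V(H)\to V(G)$ sending edges to edges. For a family $\mathcal H$ of ordered graphs, $ex_<(n,\mathcal H)$ is the maximum number of edges of an ordered graph on $[n]$ containing no copy of any member of $\mathcal H$. Two vertex-disjoint edges $xy$, $uv$ with $x<y$, $u<v$ are separated if $[x,y]\cap[u,v]=\emptyset$; nested if one of the intervals $[x,y],[u,v]$ contains the other; crossing otherwise. A $k$-matching is a set of $k$ pairwise vertex-disjoint edges. A matching is crossing if every pair of its edges crosses, and non-nested if no pair of its edges is nested. $\neg\text{Nest-}\mathcal M_k$ denotes the family of non-nested $k$-matchings. A $k$-matching is strongly non-nested if it is a disjoint union of crossing matchings such that two of its edges cross if and only if they belong to the same one of these crossing matchings (so edges from different parts are separated); $\neg\text{Nest*-}\mathcal M_k$ denotes the family of strongly non-nested $k$-matchings. *)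

theory Defs
  imports Main "HOL-Library.Disjoint_Sets"
begin

text \<open>
  An ordered graph is a pair \<open>(n, E)\<close> with vertex set \<open>{1..n}\<close>. An undirected edge \<open>xy\<close> with
  \<open>x < y\<close> is represented by the pair \<open>(x, y)\<close>.
\<close>

type_synonym edge = "nat \<times> nat"
type_synonym ograph = "nat \<times> edge set"

definition ordered_graph :: "ograph \<Rightarrow> bool" where
  "ordered_graph G \<longleftrightarrow> snd G \<subseteq> {(x, y). 1 \<le> x \<and> x < y \<and> y \<le> fst G}"

definition contains_copy :: "ograph \<Rightarrow> ograph \<Rightarrow> bool" where
  "contains_copy G H \<longleftrightarrow>
     (\<exists>f. strict_mono_on {1..fst H} f \<and> f ` {1..fst H} \<subseteq> {1..fst G} \<and>
          (\<forall>(x, y) \<in> snd H. (f x, f y) \<in> snd G))"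

text \<open>
  The maximum is over a finite set; it is meaningful only if some ordered graph on \<open>{1..n}\<close>
  avoids the family, e.g. if every member of the family has an edge.
\<close>

definition ex_ord :: "nat \<Rightarrow> ograph set \<Rightarrow> nat" where
  "ex_ord n \<H> = Max {card E |E. ordered_graph (n, E) \<and> (\<forall>H \<in> \<H>. \<not> contains_copy (n, E) H)}"

definition edge_verts :: "edge \<Rightarrow> nat set" where
  "edge_verts e = {fst e, snd e}"

definition edge_span :: "edge \<Rightarrow> nat set" where
  "edge_span e = {fst e..snd e}"

definition vertex_disjoint :: "edge \<Rightarrow> edge \<Rightarrow> bool" where
  "vertex_disjoint e f \<longleftrightarrow> edge_verts e \<inter> edge_verts f = {}"

definition separated :: "edge \<Rightarrow> edge \<Rightarrow> bool" where
  "separated e f \<longleftrightarrow> vertex_disjoint e f \<and> edge_span e \<inter> edge_span f = {}"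

definition nested :: "edge \<Rightarrow> edge \<Rightarrow> bool" where
  "nested e f \<longleftrightarrow> vertex_disjoint e f \<and> (edge_span e \<subseteq> edge_span f \<or> edge_span f \<subseteq> edge_span e)"

definition crossing :: "edge \<Rightarrow> edge \<Rightarrow> bool" where
  "crossing e f \<longleftrightarrow> vertex_disjoint e f \<and> \<not> separated e f \<and> \<not> nested e f"

definition matching :: "edge set \<Rightarrow> bool" where
  "matching M \<longleftrightarrow> finite M \<and> (\<forall>(x, y) \<in> M. x < y) \<and> pairwise vertex_disjoint M"

definition crossing_matching :: "edge set \<Rightarrow> bool" where
  "crossing_matching M \<longleftrightarrow> matching M \<and> pairwise crossing M"

definition non_nested_matching :: "edge set \<Rightarrow> bool" where
  "non_nested_matching M \<longleftrightarrow> matching M \<and> pairwise (\<lambda>e f. \<not> nested e f) M"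

text \<open>
  The third conjunct alone would still allow edges of different parts to be nested, which
  the notion is meant to exclude; hence the last conjunct.
\<close>

definition strongly_non_nested_matching :: "edge set \<Rightarrow> bool" where
  "strongly_non_nested_matching M \<longleftrightarrow> matching M \<and>
     (\<exists>P. partition_on M P \<and> (\<forall>C \<in> P. crossing_matching C) \<and>
          pairwise (\<lambda>e f. crossing e f \<longleftrightarrow> (\<exists>C \<in> P. e \<in> C \<and> f \<in> C)) M \<and>
          (\<forall>C \<in> P. \<forall>D \<in> P. C \<noteq> D \<longrightarrow> (\<forall>e \<in> C. \<forall>f \<in> D. separated e f)))"

text \<open>
  As an ordered graph, a \<open>k\<close>-matching has no isolated vertices, so its vertex set is \<open>{1..2 * k}\<close>.
\<close>

definition non_nested_family :: "nat \<Rightarrow> ograph set" where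
  "non_nested_family k =
     {(2 * k, M) |M. ordered_graph (2 * k, M) \<and> card M = k \<and> non_nested_matching M}"

definition strongly_non_nested_family :: "nat \<Rightarrow> ograph set" where
  "strongly_non_nested_family k =
     {(2 * k, M) |M. ordered_graph (2 * k, M) \<and> card M = k \<and> strongly_non_nested_matching M}"

end

theory Submission
  imports Defs "HOL-Combinatorics.Permutations" "HOL-Library.Infinite_Set"
begin

text \<open>
  The lower bound is attained by joining \<open>k - 1\<close> initial vertices to everything and adding a clique
  on the next \<open>k\<close> vertices.

  For the upper bound let \<open>s = k - 1\<close> and draw the graph as cells \<open>(x, y)\<close>, \<open>x < y\<close>, of a
  triangle. A wire enters each row \<open>y\<close> from the left, turns at the diagonal and leaves at the top of
  a column. At every cell two wires meet; they cross if the cell is a non-edge and they have not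
  crossed before, and they bounce off each other otherwise. So a row acts on the list of wires as a
  pass of bubble sort that may not sort across edges, and the number of edges is at most the number
  of inversions of the permutation \<open>u\<close> of wires leaving at the top. The number of wires above a
  threshold that leave through an initial set of columns is at most the length of a longest chain of
  edges, increasing in both coordinates, in the corresponding part of the triangle; so is the number
  of wires having an inversion with a later one. Chains through a common cut are crossing matchings,
  so they have at most \<open>s\<close> edges, and an arbitrary chain is a union of two strongly non-nested
  matchings, so it has at most \<open>2 s\<close> edges. After the corner cells with \<open>y - x \<ge> n - s\<close> have been
  added as edges, \<open>u\<close> starts with \<open>n, n - 1, \<dots>, n - s + 1\<close>; the first bound then shows that each
  later wire is inverted with at most \<open>s\<close> wires after it, and the second that at most \<open>s\<close> later
  wires have inversions at all. Hence there are at most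
  \<open>(n - 1) + \<dots> + (n - s) + s\<^sup>2 = s n + s (s - 1) / 2\<close> inversions.
\<close>

section \<open>Strict chains\<close>

definition strictly_below :: "'a::linorder \<times> 'b::linorder \<Rightarrow> 'a \<times> 'b \<Rightarrow> bool" where
  "strictly_below e f \<longleftrightarrow> fst e < fst f \<and> snd e < snd f"

definition strict_chain :: "('a::linorder \<times> 'b::linorder) set \<Rightarrow> bool" where
  "strict_chain C \<longleftrightarrow> pairwise (\<lambda>e f. strictly_below e f \<or> strictly_below f e) C"

definition longest_chain :: "('a::linorder \<times> 'b::linorder) set \<Rightarrow> nat" where
  "longest_chain F = Max (card ` {C. C \<subseteq> F \<and> strict_chain C})"

lemma strict_chainD:
  "strict_chain C \<Longrightarrow> e \<in> C \<Longrightarrow> f \<in> C \<Longrightarrow> e \<noteq> f \<Longrightarrow> strictly_below e f \<or> strictly_below f e"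
  unfolding strict_chain_def by (rule pairwiseD)

lemma strict_chain_subset: "strict_chain C \<Longrightarrow> D \<subseteq> C \<Longrightarrow> strict_chain D"
  unfolding strict_chain_def by (rule pairwise_subset)

lemma strict_chain_insert:
  "strict_chain C \<Longrightarrow> (\<And>f. f \<in> C \<Longrightarrow> strictly_below f e) \<Longrightarrow> strict_chain (insert e C)"
  unfolding strict_chain_def pairwise_insert by blast

lemma finite_subset_cards: "finite F \<Longrightarrow> finite (card ` {C. C \<subseteq> F \<and> P C})"
  by (rule finite_imageI, rule finite_subset[of _ "Pow F"]) auto

lemma card_le_longest_chain:
  "finite F \<Longrightarrow> C \<subseteq> F \<Longrightarrow> strict_chain C \<Longrightarrow> card C \<le> longest_chain F"
  unfolding longest_chain_def by (intro Max_ge finite_subset_cards) auto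

lemma longest_chain_obtain:
  assumes "finite F"
  obtains C where "C \<subseteq> F" "strict_chain C" "card C = longest_chain F"
proof -
  have "{} \<in> {C. C \<subseteq> F \<and> strict_chain C}"
    by (simp add: strict_chain_def)
  then have "longest_chain F \<in> card ` {C. C \<subseteq> F \<and> strict_chain C}"
    unfolding longest_chain_def by (intro Max_in finite_subset_cards assms) blast
  then show thesis
    using that by auto
qed

lemma longest_chain_le:
  assumes "finite F" "\<And>C. C \<subseteq> F \<Longrightarrow> strict_chain C \<Longrightarrow> card C \<le> b"
  shows "longest_chain F \<le> b"
  using assms by (metis longest_chain_obtain)

lemma longest_chain_mono:
  assumes "finite G" "F \<subseteq> G"
  shows "longest_chain F \<le> longest_chain G"
proof -
  obtain C where "C \<subseteq> F" "strict_chain C" "card C = longest_chain F"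
    using assms by (metis finite_subset longest_chain_obtain)
  then show ?thesis
    using assms card_le_longest_chain[of G C] by auto
qed

lemma Suc_longest_chain_le:
  assumes "finite G" "F \<subseteq> G" "e \<in> G" "\<And>f. f \<in> F \<Longrightarrow> strictly_below f e"
  shows "Suc (longest_chain F) \<le> longest_chain G"
proof -
  obtain C where C: "C \<subseteq> F" "strict_chain C" "card C = longest_chain F"
    using assms(1,2) by (metis finite_subset longest_chain_obtain)
  have "finite C" "e \<notin> C"
    using assms(1,2) assms(4)[of e] C(1) finite_subset[of C G] by (auto simp: strictly_below_def)
  then have "card (insert e C) = Suc (longest_chain F)"
    using C(3) by simp
  moreover have "strict_chain (insert e C)"
    using assms(4) C by (intro strict_chain_insert) auto
  ultimately show ?thesis
    using card_le_longest_chain[of G "insert e C"] assms(1-3) C(1) by auto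
qed

lemma card_strict_chain_le:
  fixes C :: "(nat \<times> nat) set"
  assumes C: "strict_chain C" "(x0, y0) \<in> C" and bounds: "C \<subseteq> {1..} \<times> {..n}"
  shows "card C \<le> x0 + (n - y0)"
proof -
  let ?L = "{e \<in> C. fst e \<le> x0}" and ?R = "{e \<in> C. x0 < fst e}"
  have "card ?L \<le> card {1..x0}"
  proof (rule card_inj_on_le)
    show "inj_on fst ?L"
      using strict_chainD[OF C(1)] by (force simp: inj_on_def strictly_below_def)
  qed (use bounds in auto)
  moreover have "card ?R \<le> card {y0<..n}"
  proof (rule card_inj_on_le)
    show "inj_on snd ?R"
      using strict_chainD[OF C(1)] by (force simp: inj_on_def strictly_below_def)
    show "snd ` ?R \<subseteq> {y0<..n}"
      using bounds strict_chainD[OF C(1) _ C(2)] by (force simp: strictly_below_def)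
  qed auto
  moreover have "C = ?L \<union> ?R"
    by auto
  then have "card C \<le> card ?L + card ?R"
    by (metis card_Un_le)
  ultimately show ?thesis
    by simp
qed

section \<open>Bubble passes with barriers\<close>

definition sort_adjacent :: "nat \<Rightarrow> (nat \<Rightarrow> 'a::linorder) \<Rightarrow> nat \<Rightarrow> 'a" where
  "sort_adjacent q v = (if v (Suc q) < v q then v \<circ> transpose q (Suc q) else v)"

primrec bubble_pass :: "nat set \<Rightarrow> nat \<Rightarrow> (nat \<Rightarrow> 'a::linorder) \<Rightarrow> nat \<Rightarrow> 'a" where
  "bubble_pass B 0 v = v"
| "bubble_pass B (Suc q) v =
     (if q \<in> B then bubble_pass B q v else sort_adjacent q (bubble_pass B q v))"

lemma bubble_pass_eq_permuted: "\<exists>\<pi>. \<pi> permutes {..q} \<and> bubble_pass B q v = v \<circ> \<pi>"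
proof (induction q)
  case 0
  then show ?case
    using permutes_id by fastforce
next
  case (Suc q)
  then obtain \<pi> where \<pi>: "\<pi> permutes {..q}" "bubble_pass B q v = v \<circ> \<pi>"
    by blast
  have \<pi>_Suc: "\<pi> permutes {..Suc q}"
    using \<pi>(1) by (rule permutes_subset) auto
  moreover have "transpose q (Suc q) permutes {..Suc q}"
    by (rule permutes_swap_id) auto
  ultimately have "\<pi> \<circ> transpose q (Suc q) permutes {..Suc q}"
    by (metis permutes_compose)
  moreover have "bubble_pass B (Suc q) v \<in> {v \<circ> \<pi>, v \<circ> (\<pi> \<circ> transpose q (Suc q))}"
    by (simp add: \<pi>(2) sort_adjacent_def comp_assoc)
  ultimately show ?case
    using \<pi>_Suc by blast
qed

lemma image_bubble_pass: "bubble_pass B q v ` {..q} = v ` {..q}"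
  by (metis bubble_pass_eq_permuted image_comp permutes_image)

lemma bubble_pass_at_barriers:
  assumes "{..i} \<subseteq> B"
  shows "bubble_pass B q v i = v i"
proof (induction q)
  case (Suc q)
  moreover have "sort_adjacent q w i = w i" if "q \<notin> B" for w :: "nat \<Rightarrow> 'a"
  proof -
    have "\<not> q \<le> i"
      using that assms by auto
    then show ?thesis
      by (simp add: sort_adjacent_def transpose_def)
  qed
  ultimately show ?case
    by simp
qed simp

subsection \<open>Inversions\<close>

definition inversions_at :: "nat \<Rightarrow> (nat \<Rightarrow> 'a::linorder) \<Rightarrow> nat \<Rightarrow> nat set" where
  "inversions_at n v i = {j. i < j \<and> j < n \<and> v j < v i}"

definition inversions :: "nat \<Rightarrow> (nat \<Rightarrow> 'a::linorder) \<Rightarrow> (nat \<times> nat) set" where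
  "inversions n v = (SIGMA i:{..<n}. inversions_at n v i)"

definition inverted :: "nat \<Rightarrow> (nat \<Rightarrow> 'a::linorder) \<Rightarrow> nat set" where
  "inverted n v = {i. inversions_at n v i \<noteq> {}}"

lemma finite_inversions_at [simp]: "finite (inversions_at n v i)"
  by (simp add: inversions_at_def)

lemma finite_inversions [simp]: "finite (inversions n v)"
  by (simp add: inversions_def)

lemma card_inversions: "card (inversions n v) = (\<Sum>i<n. card (inversions_at n v i))"
  by (simp add: inversions_def)

lemma card_inversions_sort_adjacent:
  assumes "Suc q < n"
  shows "card (inversions n v) \<le> Suc (card (inversions n (sort_adjacent q v)))"
proof (cases "v (Suc q) < v q")
  case True
  let ?t = "transpose q (Suc q)"
  have "map_prod ?t ?t ` (inversions n v - {(q, Suc q)}) \<subseteq> inversions n (v \<circ> ?t)"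
    using assms
    by (auto simp: inversions_def inversions_at_def) (auto simp: transpose_def split: if_splits)
  then have "card (inversions n v - {(q, Suc q)}) \<le> card (inversions n (v \<circ> ?t))"
    by (rule card_inj_on_le[rotated]) (auto intro: inj_on_subset[OF prod.inj_map])
  then show ?thesis
    using True card_Suc_Diff1[of "inversions n v" "(q, Suc q)"] assms
    by (simp add: sort_adjacent_def inversions_def inversions_at_def)
qed (simp add: sort_adjacent_def)

lemma card_inversions_bubble_pass:
  assumes "q < n"
  shows "card (inversions n v) \<le> card (inversions n (bubble_pass B q v)) + card ({..<q} - B)"
  using assms
proof (induction q)
  case (Suc q)
  then have IH: "card (inversions n v) \<le> card (inversions n (bubble_pass B q v)) + card ({..<q} - B)"
    by simp
  show ?case
  proof (cases "q \<in> B")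
    case True
    then show ?thesis
      using IH by (simp add: lessThan_Suc insert_Diff_if)
  next
    case False
    then show ?thesis
      using IH card_inversions_sort_adjacent[OF Suc.prems, of "bubble_pass B q v"]
      by (simp add: lessThan_Suc insert_Diff_if)
  qed
qed simp

lemma inversions_at_case_nat_0:
  "(\<And>i. i < n \<Longrightarrow> w i < a) \<Longrightarrow> inversions_at (Suc n) (case_nat a w) 0 = {0<..n}"
  by (auto simp: inversions_at_def gr0_conv_Suc split: nat.splits)

lemma inversions_at_case_nat_Suc:
  "inversions_at (Suc n) (case_nat a w) (Suc i) = Suc ` inversions_at n w i"
proof -
  have "j \<in> Suc ` inversions_at n w i" if "j \<in> inversions_at (Suc n) (case_nat a w) (Suc i)" for j
    using that by (cases j) (auto simp: inversions_at_def)
  then show ?thesis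
    by (auto simp: inversions_at_def)
qed

lemma inverted_case_nat: "Suc -` inverted (Suc n) (case_nat a w) = inverted n w"
  by (auto simp: inverted_def inversions_at_case_nat_Suc)

lemma inverted_Suc_subset: "inverted (Suc n) v \<subseteq> {..<n}"
  by (auto simp: inverted_def inversions_at_def)

lemma inverted_subset: "inverted n v \<subseteq> {..<n}"
  by (auto simp: inverted_def inversions_at_def)

lemma card_inversions_case_nat:
  assumes "\<And>i. i < n \<Longrightarrow> w i < a"
  shows "card (inversions (Suc n) (case_nat a w)) = n + card (inversions n w)"
  using assms unfolding card_inversions sum.lessThan_Suc_shift
  by (simp add: inversions_at_case_nat_0 inversions_at_case_nat_Suc card_image)

subsection \<open>Markings that sorting does not spread\<close>

definition sorting_compatible :: "nat \<Rightarrow> ((nat \<Rightarrow> 'a::linorder) \<Rightarrow> nat set) \<Rightarrow> bool" where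
  "sorting_compatible n M \<longleftrightarrow>
     (\<forall>v q. Suc q < n \<longrightarrow>
        (\<forall>i. i \<noteq> q \<and> i \<noteq> Suc q \<longrightarrow> (i \<in> M (sort_adjacent q v) \<longleftrightarrow> i \<in> M v)) \<and>
        (q \<in> M (sort_adjacent q v) \<longrightarrow> q \<in> M v \<and> Suc q \<in> M v) \<and>
        (Suc q \<in> M (sort_adjacent q v) \<longrightarrow> q \<in> M v \<or> Suc q \<in> M v))"

lemma sorting_compatibleD:
  assumes "sorting_compatible n M" "Suc q < n"
  shows "i \<noteq> q \<Longrightarrow> i \<noteq> Suc q \<Longrightarrow> i \<in> M (sort_adjacent q v) \<longleftrightarrow> i \<in> M v"
    and "q \<in> M (sort_adjacent q v) \<Longrightarrow> q \<in> M v \<and> Suc q \<in> M v"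
    and "Suc q \<in> M (sort_adjacent q v) \<Longrightarrow> q \<in> M v \<or> Suc q \<in> M v"
  using assms by (simp_all add: sorting_compatible_def)

lemma sorting_compatible_above: "sorting_compatible n (\<lambda>v. {i. p < v i})"
  by (auto simp: sorting_compatible_def sort_adjacent_def transpose_def)

lemma inversions_at_transpose:
  assumes "Suc q < n" "i \<noteq> q" "i \<noteq> Suc q"
  shows "inversions_at n (v \<circ> transpose q (Suc q)) i = transpose q (Suc q) ` inversions_at n v i"
proof -
  let ?t = "transpose q (Suc q)"
  have "?t j < n \<longleftrightarrow> j < n" "i < ?t j \<longleftrightarrow> i < j" for j
    using assms by (auto simp: transpose_def)
  then have "inversions_at n (v \<circ> ?t) i = ?t -` inversions_at n v i"
    using assms by (auto simp: inversions_at_def)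
  also have "\<dots> = ?t ` inversions_at n v i"
    by (metis bij_transpose bij_vimage_eq_inv_image inv_transpose_eq)
  finally show ?thesis .
qed

lemma sorting_compatible_inverted: "sorting_compatible n (inverted n)"
  unfolding sorting_compatible_def
proof (intro allI impI)
  fix v :: "nat \<Rightarrow> 'a" and q
  assume q: "Suc q < n"
  let ?v = "sort_adjacent q v"
  have "inversions_at n ?v i = {} \<longleftrightarrow> inversions_at n v i = {}" if "i \<noteq> q" "i \<noteq> Suc q" for i
    using that q by (simp add: sort_adjacent_def inversions_at_transpose)
  moreover have "inversions_at n ?v q \<subseteq> inversions_at n v q \<inter> inversions_at n v (Suc q)"
    "inversions_at n ?v (Suc q) \<subseteq> inversions_at n v q \<union> inversions_at n v (Suc q)"
    using q by (auto simp: sort_adjacent_def inversions_at_def transpose_def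
      split: if_splits intro!: Suc_lessI)
  ultimately show "(\<forall>i. i \<noteq> q \<and> i \<noteq> Suc q \<longrightarrow> (i \<in> inverted n ?v \<longleftrightarrow> i \<in> inverted n v)) \<and>
      (q \<in> inverted n ?v \<longrightarrow> q \<in> inverted n v \<and> Suc q \<in> inverted n v) \<and>
      (Suc q \<in> inverted n ?v \<longrightarrow> q \<in> inverted n v \<or> Suc q \<in> inverted n v)"
    unfolding inverted_def by blast
qed

lemma card_marked_sort_adjacent:
  assumes "sorting_compatible n M" "Suc q < n"
  shows "card (M (sort_adjacent q v) \<inter> {..<r}) \<le> card (M v \<inter> {..<r})"
proof -
  let ?M = "M v \<inter> {..<r}" and ?M' = "M (sort_adjacent q v) \<inter> {..<r}"
  note compatible = sorting_compatibleD[OF assms, where v = v]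
  show ?thesis
  proof (cases "?M' \<subseteq> ?M")
    case True
    then show ?thesis
      by (simp add: card_mono)
  next
    case False
    then obtain i where "i \<in> ?M'" "i \<notin> ?M"
      by blast
    then have new: "Suc q \<in> ?M'" "Suc q \<notin> ?M"
      using compatible(1)[of i] compatible(2) by (cases "i = q"; cases "i = Suc q"; auto)+
    then have old: "q \<in> ?M" "q \<notin> ?M'"
      using compatible(2,3) by auto
    have "i \<in> insert (Suc q) (?M - {q})" if "i \<in> ?M'" for i
      using that old compatible(1)[of i] by (cases "i = q") auto
    then have "?M' \<subseteq> insert (Suc q) (?M - {q})"
      by blast
    then have "card ?M' \<le> card (insert (Suc q) (?M - {q}))"
      by (intro card_mono) auto
    also have "\<dots> = card ?M"
      using new(2) old(1) card_Suc_Diff1[of ?M q] by simp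
    finally show ?thesis .
  qed
qed

lemma card_marked_bubble_pass:
  assumes "sorting_compatible n M" "q < n"
  shows "card (M (bubble_pass B q v) \<inter> {..<r}) \<le> card (M v \<inter> {..<r})"
  using assms(2)
proof (induction q)
  case (Suc q)
  then show ?case
    using card_marked_sort_adjacent[OF assms(1) Suc.prems, of "bubble_pass B q v" r] by simp
qed simp

lemma marked_bubble_pass_above:
  assumes "sorting_compatible n M" "q < n" "q < i"
  shows "i \<in> M (bubble_pass B q v) \<longleftrightarrow> i \<in> M v"
  using assms(2,3)
proof (induction q)
  case (Suc q)
  then have "i \<in> M (sort_adjacent q (bubble_pass B q v)) \<longleftrightarrow> i \<in> M (bubble_pass B q v)"
    by (intro sorting_compatibleD[OF assms(1)]) simp_all
  then show ?case
    using Suc by simp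
qed simp

lemma marked_sort_adjacent_below:
  assumes "sorting_compatible n M" "Suc q < n" "r \<le> q"
  shows "M (sort_adjacent q v) \<inter> {..<r} = M v \<inter> {..<r}"
  using sorting_compatibleD(1)[OF assms(1,2)] assms(3) by auto

lemma card_Int_lessThan_Suc_le: "card (S \<inter> {..<Suc q}) \<le> Suc (card (Suc -` S \<inter> {..<q}))"
proof -
  have "S \<inter> {..<Suc q} \<subseteq> insert 0 (Suc ` (Suc -` S \<inter> {..<q}))"
    by (auto simp: less_Suc_eq_0_disj)
  then have "card (S \<inter> {..<Suc q}) \<le> card (insert 0 (Suc ` (Suc -` S \<inter> {..<q})))"
    by (intro card_mono) auto
  also have "\<dots> \<le> Suc (card (Suc -` S \<inter> {..<q}))"
    by (simp add: card_insert_if card_image)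
  finally show ?thesis .
qed

text \<open>
  The entry at position \<open>0\<close> moves into the list of the other entries, whose marks are \<open>Suc -` M v\<close>.
  Only a barrier can leave an additional mark in a prefix, since sorting puts an unmarked entry
  to the left of a marked one.
\<close>

lemma card_marked_bubble_pass_cases:
  assumes M: "sorting_compatible n M" and q: "q < n" and r: "r \<le> q"
  shows "card (M (bubble_pass B q v) \<inter> {..<r}) \<le> card (Suc -` M v \<inter> {..<r}) \<or>
    (\<exists>k<r. k \<in> B \<and> card (M (bubble_pass B q v) \<inter> {..<r}) \<le> Suc (card (Suc -` M v \<inter> {..<k})))"
  using q r
proof (induction q arbitrary: r)
  case (Suc q)
  let ?w = "bubble_pass B q v" and ?w' = "bubble_pass B (Suc q) v"
  have prefix: "M ?w' \<inter> {..<k} = M ?w \<inter> {..<k}" if "k \<le> q" for k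
    using marked_sort_adjacent_below[OF M Suc.prems(1) that] by simp
  have total: "card (M ?w' \<inter> {..<Suc q}) \<le> Suc (card (Suc -` M v \<inter> {..<q}))"
    using card_marked_bubble_pass[OF M Suc.prems(1)] card_Int_lessThan_Suc_le by (rule order.trans)
  consider (below) "r \<le> q" | (barrier) "r = Suc q" "q \<in> B" | (marked) "r = Suc q" "Suc q \<in> M v"
    | (unmarked) "r = Suc q" "q \<notin> B" "Suc q \<notin> M v"
    using Suc.prems(2) by linarith
  then show ?case
  proof cases
    case below
    then show ?thesis
      using Suc.IH[OF _ below] Suc.prems(1) unfolding prefix[OF below]
      by (meson Suc_lessD)
  next
    case barrier
    then show ?thesis
      using total by blast
  next
    case marked
    then show ?thesis
      using total by (simp add: lessThan_Suc)
  next
    case unmarked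
    have "Suc q \<notin> M ?w"
      using unmarked(3) marked_bubble_pass_above[OF M, of q "Suc q"] Suc.prems(1) by simp
    then have "q \<notin> M ?w'"
      using sorting_compatibleD(2)[OF M Suc.prems(1), of ?w] unmarked(2) by auto
    then have "M ?w' \<inter> {..<r} = M ?w \<inter> {..<q}"
      using prefix[of q] unmarked(1) by (simp add: lessThan_Suc)
    moreover have "Suc -` M v \<inter> {..<r} = Suc -` M v \<inter> {..<q}"
      using unmarked(1,3) by (simp add: lessThan_Suc)
    ultimately show ?thesis
      using Suc.IH[of q] Suc.prems(1) unfolding unmarked(1) by (metis Suc_lessD less_SucI order.refl)
  qed
qed simp

section \<open>The wiring of an edge set\<close>

text \<open>
  The wire entering row \<open>m\<close> from the left is called \<open>m\<close>, and \<open>wires F m i\<close> is the wire that leaves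
  the first \<open>m\<close> rows through column \<open>Suc i\<close>, for \<open>i < m\<close>; for \<open>i \<ge> m\<close> it is the dummy value \<open>0\<close>.
\<close>

primrec wires :: "edge set \<Rightarrow> nat \<Rightarrow> nat \<Rightarrow> nat" where
  "wires F 0 = (\<lambda>_. 0)"
| "wires F (Suc m) = bubble_pass {i. (Suc i, Suc m) \<in> F} m (case_nat (Suc m) (wires F m))"

lemma wires_le: "wires F m i \<le> m"
proof (induction m arbitrary: i)
  case (Suc m)
  then have "case_nat (Suc m) (wires F m) j \<le> Suc m" for j
    by (simp add: le_SucI split: nat.split)
  then show ?case
    using bubble_pass_eq_permuted by (metis comp_apply wires.simps(2))
qed simp

lemma bij_betw_wires: "bij_betw (wires F m) {..<m} {1..m}"
proof -
  have image: "wires F m ` {..<m} = {1..m}"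
  proof (induction m)
    case (Suc m)
    have "wires F (Suc m) ` {..<Suc m} = case_nat (Suc m) (wires F m) ` {..<Suc m}"
      by (simp add: lessThan_Suc_atMost image_bubble_pass)
    also have "\<dots> = insert (Suc m) (wires F m ` {..<m})"
      by (simp add: lessThan_Suc_eq_insert_0 image_image)
    finally show ?case
      using Suc.IH by auto
  qed simp
  then have "inj_on (wires F m) {..<m}"
    by (intro eq_card_imp_inj_on) simp_all
  then show ?thesis
    using image by (simp add: bij_betw_def)
qed

definition corner :: "nat \<Rightarrow> nat \<Rightarrow> edge set" where
  "corner t n = {(x, y). 1 \<le> x \<and> x + t \<le> y \<and> y \<le> n}"

lemma wires_if_corner_subset:
  assumes "corner t n \<subseteq> F" "i < j" "t + j \<le> n"
  shows "wires F (t + j) i = t + j - i"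
  using assms(2,3)
proof (induction j arbitrary: i)
  case (Suc j)
  then have "{..i} \<subseteq> {i. (Suc i, Suc (t + j)) \<in> F}"
    using assms(1) by (auto simp: corner_def)
  then have "wires F (t + Suc j) i = case_nat (Suc (t + j)) (wires F (t + j)) i"
    using bubble_pass_at_barriers by simp
  then show ?case
    using Suc by (cases i) auto
qed simp

subsection \<open>Edges and inversions\<close>

lemma card_edges_le_card_inversions:
  assumes "F \<subseteq> {(x, y). 1 \<le> x \<and> x < y}"
  shows "card {e \<in> F. snd e \<le> m} \<le> card (inversions m (wires F m))"
proof (induction m)
  case 0
  have "{e \<in> F. snd e \<le> 0} = {}"
    using assms by force
  then show ?case
    by (metis card.empty zero_le)
next
  case (Suc m)
  let ?B = "{i. (Suc i, Suc m) \<in> F}" and ?v = "case_nat (Suc m) (wires F m)"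
  have "{e \<in> F. snd e \<le> Suc m} = {e \<in> F. snd e \<le> m} \<union> {e \<in> F. snd e = Suc m}"
    by auto
  also have "{e \<in> F. snd e = Suc m} = (\<lambda>i. (Suc i, Suc m)) ` (?B \<inter> {..<m})"
    using assms by (force simp: image_iff gr0_conv_Suc Suc_le_eq)
  also have "card ({e \<in> F. snd e \<le> m} \<union> \<dots>) \<le> card {e \<in> F. snd e \<le> m} + card (?B \<inter> {..<m})"
    by (rule order.trans[OF card_Un_le]) (simp add: card_image_le)
  finally have "card {e \<in> F. snd e \<le> Suc m} \<le> card (inversions m (wires F m)) + card (?B \<inter> {..<m})"
    using Suc.IH by simp
  moreover have "m + card (inversions m (wires F m)) = card (inversions (Suc m) ?v)"
    using wires_le by (intro card_inversions_case_nat[symmetric]) (simp add: less_Suc_eq_le)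
  moreover have "card (inversions (Suc m) ?v)
      \<le> card (inversions (Suc m) (wires F (Suc m))) + card ({..<m} - ?B)"
    using card_inversions_bubble_pass[of m "Suc m" ?v ?B] by simp
  moreover have "card ({..<m} - ?B) + card (?B \<inter> {..<m}) = m"
    using card_Int_Diff[of "{..<m}" ?B] by (simp add: Int_commute)
  ultimately show ?case
    by linarith
qed

subsection \<open>Wires and longest chains\<close>

definition subgrid :: "edge set \<Rightarrow> nat \<Rightarrow> nat \<Rightarrow> nat \<Rightarrow> edge set" where
  "subgrid F q p m = {(x, y) \<in> F. x \<le> q \<and> p < y \<and> y \<le> m}"

lemma finite_subgrid [simp]: "finite (subgrid F q p m)"
  by (rule finite_subset[of _ "{..q} \<times> {..m}"]) (auto simp: subgrid_def)

lemma longest_chain_subgrid_mono: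
  "q \<le> q' \<Longrightarrow> m \<le> m' \<Longrightarrow> longest_chain (subgrid F q p m) \<le> longest_chain (subgrid F q' p m')"
  by (intro longest_chain_mono finite_subgrid) (auto simp: subgrid_def)

lemma Suc_longest_chain_subgrid_le:
  assumes "(Suc k, Suc m) \<in> F" "k < q" "p \<le> m"
  shows "Suc (longest_chain (subgrid F k p m)) \<le> longest_chain (subgrid F q p (Suc m))"
  by (rule Suc_longest_chain_le[where e = "(Suc k, Suc m)", OF finite_subgrid])
     (use assms in \<open>auto simp: subgrid_def strictly_below_def\<close>)

lemma card_marked_wires_Suc:
  assumes M: "sorting_compatible (Suc m) M" and "q \<le> m" "p \<le> m"
    and marks: "\<And>k. k \<le> q \<Longrightarrow> card (Suc -` M (case_nat (Suc m) (wires F m)) \<inter> {..<k})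
      \<le> longest_chain (subgrid F k p m)"
  shows "card (M (wires F (Suc m)) \<inter> {..<q}) \<le> longest_chain (subgrid F q p (Suc m))"
proof -
  let ?A = "Suc -` M (case_nat (Suc m) (wires F m))"
  consider (unchanged) "card (M (wires F (Suc m)) \<inter> {..<q}) \<le> card (?A \<inter> {..<q})"
    | (edge) k where "k < q" "(Suc k, Suc m) \<in> F"
        "card (M (wires F (Suc m)) \<inter> {..<q}) \<le> Suc (card (?A \<inter> {..<k}))"
    using card_marked_bubble_pass_cases[OF M _ \<open>q \<le> m\<close>] by auto
  then show ?thesis
  proof cases
    case unchanged
    also note marks[OF order.refl]
    also have "longest_chain (subgrid F q p m) \<le> longest_chain (subgrid F q p (Suc m))"
      by (simp add: longest_chain_subgrid_mono)
    finally show ?thesis .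
  next
    case (edge k)
    note edge(3)
    also have "Suc (card (?A \<inter> {..<k})) \<le> Suc (longest_chain (subgrid F k p m))"
      using marks edge(1) by simp
    also have "\<dots> \<le> longest_chain (subgrid F q p (Suc m))"
      using edge(1,2) \<open>p \<le> m\<close> by (intro Suc_longest_chain_subgrid_le)
    finally show ?thesis .
  qed
qed

lemma card_wires_above:
  "q \<le> p \<Longrightarrow> card ({i. p < wires F m i} \<inter> {..<q}) \<le> longest_chain (subgrid F q p m)"
proof (induction m arbitrary: q)
  case (Suc m)
  show ?case
  proof (cases "Suc m \<le> p")
    case True
    then have "{i. p < wires F (Suc m) i} = {}"
      using wires_le[of F "Suc m"] by (auto simp: not_less intro: le_trans simp del: wires.simps)
    then show ?thesis
      by (metis card.empty Int_empty_left zero_le)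
  next
    case False
    have "Suc -` {i. p < case_nat (Suc m) (wires F m) i} = {i. p < wires F m i}"
      by auto
    then show ?thesis
      using Suc False
      by (intro card_marked_wires_Suc[where M = "\<lambda>v. {i. p < v i}"] sorting_compatible_above) auto
  qed
qed simp

lemma card_inverted_wires_Int:
  "q \<le> m \<Longrightarrow> card (inverted m (wires F m) \<inter> {..<q}) \<le> longest_chain (subgrid F q 0 m)"
proof (induction m arbitrary: q)
  case (Suc m)
  have "inverted (Suc m) (wires F (Suc m)) \<inter> {..<q} = inverted (Suc m) (wires F (Suc m)) \<inter> {..<min q m}"
    using inverted_Suc_subset[of m "wires F (Suc m)"] by auto
  also have "card \<dots> \<le> longest_chain (subgrid F (min q m) 0 (Suc m))"
    using Suc.IH
    by (intro card_marked_wires_Suc[OF sorting_compatible_inverted]) (auto simp: inverted_case_nat)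
  also have "\<dots> \<le> longest_chain (subgrid F q 0 (Suc m))"
    by (simp add: longest_chain_subgrid_mono)
  finally show ?case .
qed (simp add: inverted_def inversions_at_def)

lemma card_inverted_wires: "card (inverted m (wires F m)) \<le> longest_chain (subgrid F m 0 m)"
  using card_inverted_wires_Int[of m m F] inverted_subset[of m "wires F m"] by (simp add: Int_absorb2)

section \<open>Permutations with few exceedances\<close>

definition exceeding :: "(nat \<Rightarrow> nat) \<Rightarrow> nat \<Rightarrow> nat set" where
  "exceeding u p = {i. i < p \<and> p < u i}"

lemma card_exceeding:
  assumes u: "bij_betw u {..<n} {1..n}" and "p \<le> n"
  shows "card (exceeding u p) = card {i \<in> {p..<n}. u i \<le> p}"
proof -
  let ?small = "{i \<in> {..<n}. u i \<le> p}"
  have "u ` ?small = {x \<in> u ` {..<n}. x \<le> p}"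
    by auto
  also have "\<dots> = {1..p}"
    using bij_betw_imp_surj_on[OF u] \<open>p \<le> n\<close> by auto
  finally have "card (u ` ?small) = p"
    by simp
  moreover have "inj_on u ?small"
    using bij_betw_imp_inj_on[OF u] by (rule inj_on_subset) auto
  ultimately have "card ?small = card {..<p}"
    by (simp add: card_image)
  then have "card ({..<p} - ?small) = card (?small - {..<p})"
    by (simp add: card_Diff_subset_Int Int_commute)
  moreover have "{..<p} - ?small = exceeding u p" "?small - {..<p} = {i \<in> {p..<n}. u i \<le> p}"
    using \<open>p \<le> n\<close> by (auto simp: exceeding_def)
  ultimately show ?thesis
    by simp
qed

lemma card_inversions_at_le:
  assumes u: "bij_betw u {..<n} {1..n}" and "i < n" "u i \<le> Suc i"
    and exceeding: "\<And>p. card (exceeding u p) \<le> s"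
  shows "card (inversions_at n u i) \<le> s"
proof -
  define p where "p = u i - 1"
  have "u i \<in> {1..n}"
    using u \<open>i < n\<close> by (auto simp: bij_betw_def)
  then have p: "u i = Suc p" "p \<le> n" "p \<le> i"
    using assms(3) by (auto simp: p_def)
  then have "inversions_at n u i \<subseteq> {j \<in> {p..<n}. u j \<le> p}"
    by (auto simp: inversions_at_def)
  then have "card (inversions_at n u i) \<le> card {j \<in> {p..<n}. u j \<le> p}"
    by (intro card_mono) auto
  also have "\<dots> \<le> s"
    using exceeding[of p] card_exceeding[OF u p(2)] by simp
  finally show ?thesis .
qed

lemma late_value_le_Suc:
  assumes u: "bij_betw u {..<n} {1..n}" and initial: "\<And>i. i < s \<Longrightarrow> u i = n - i"
    and exceeding: "\<And>p. card (exceeding u p) \<le> s"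
    and i: "s \<le> i" "i < n"
  shows "u i \<le> Suc i"
proof (rule ccontr)
  assume large: "\<not> u i \<le> Suc i"
  have "u i \<le> n - s"
  proof (rule ccontr)
    assume "\<not> u i \<le> n - s"
    moreover have "u i \<in> {1..n}"
      using u i by (auto simp: bij_betw_def)
    ultimately have early: "n - u i < s" "n - u i < n" "u (n - u i) = u i"
      using initial[of "n - u i"] by auto
    then have "n - u i = i"
      using inj_onD[OF bij_betw_imp_inj_on[OF u], of "n - u i" i] i by simp
    then show False
      using early i by simp
  qed
  then have "insert i {..<s} \<subseteq> exceeding u (Suc i)"
    using i large initial by (auto simp: exceeding_def)
  then have "card (insert i {..<s}) \<le> card (exceeding u (Suc i))"
    by (intro card_mono) (auto simp: exceeding_def)
  also have "\<dots> \<le> s"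
    by (rule exceeding)
  finally show False
    using i by simp
qed

lemma initial_descending_inverted:
  assumes u: "bij_betw u {..<n} {1..n}" and initial: "\<And>j. j \<le> i \<Longrightarrow> u j = n - j"
    and "Suc i < n"
  shows "i \<in> inverted n u"
proof -
  have "n - Suc i \<in> u ` {..<n}"
    using u \<open>Suc i < n\<close> by (simp add: bij_betw_imp_surj_on)
  then obtain j where j: "j < n" "u j = n - Suc i"
    by auto
  then have "i < j"
    using initial[of j] \<open>Suc i < n\<close> by (cases "j \<le> i") auto
  then show ?thesis
    using j initial[of i] \<open>Suc i < n\<close> by (auto simp: inverted_def inversions_at_def)
qed

lemma sum_descending_plus_square:
  "s \<le> n \<Longrightarrow> (\<Sum>i<s. n - 1 - i) + s * s = s * n + (s choose 2)"
proof (induction s)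
  case (Suc s)
  then show ?case
    by (simp add: numeral_2_eq_2)
qed simp

lemma card_late_inverted_le:
  assumes u: "bij_betw u {..<n} {1..n}" and initial: "\<And>i. i < s \<Longrightarrow> u i = n - i"
    and inverted: "card (inverted n u) \<le> 2 * s" and n: "2 * s \<le> n"
  shows "card (inverted n u - {..<s}) \<le> s"
proof -
  have "{..<s} \<subseteq> inverted n u"
    using n initial initial_descending_inverted[OF u] by auto
  then have "card (inverted n u - {..<s}) = card (inverted n u) - s"
    by (simp add: card_Diff_subset)
  then show ?thesis
    using inverted by simp
qed

lemma card_inversions_le:
  assumes u: "bij_betw u {..<n} {1..n}" and initial: "\<And>i. i < s \<Longrightarrow> u i = n - i"
    and exceeding: "\<And>p. card (exceeding u p) \<le> s"
    and inverted: "card (inverted n u) \<le> 2 * s" and n: "2 * s \<le> n"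
  shows "card (inversions n u) \<le> s * n + (s choose 2)"
proof -
  have early: "(\<Sum>i<s. card (inversions_at n u i)) \<le> (\<Sum>i<s. n - 1 - i)"
  proof (rule sum_mono)
    fix i
    have "card (inversions_at n u i) \<le> card {i<..<n}"
      by (intro card_mono) (auto simp: inversions_at_def)
    then show "card (inversions_at n u i) \<le> n - 1 - i"
      by simp
  qed
  let ?late = "inverted n u - {..<s}"
  have "(\<Sum>i=s..<n. card (inversions_at n u i)) = (\<Sum>i\<in>?late. card (inversions_at n u i))"
    using inverted_subset[of n u] by (intro sum.mono_neutral_right) (auto simp: inverted_def)
  also have "\<dots> \<le> of_nat (card ?late) * s"
  proof (intro sum_bounded_above card_inversions_at_le[OF u _ _ exceeding])
    fix i
    assume "i \<in> ?late"
    then show "i < n" "u i \<le> Suc i"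
      using inverted_subset[of n u] late_value_le_Suc[OF u initial exceeding] by auto
  qed
  also have "\<dots> \<le> s * s"
    using card_late_inverted_le[OF u initial inverted n] by simp
  finally have late: "(\<Sum>i=s..<n. card (inversions_at n u i)) \<le> s * s" .
  have "card (inversions n u) =
      (\<Sum>i<s. card (inversions_at n u i)) + (\<Sum>i=s..<n. card (inversions_at n u i))"
    unfolding card_inversions lessThan_atLeast0 using n by (simp add: sum.atLeastLessThan_concat)
  then show ?thesis
    using early late sum_descending_plus_square[of s n] n by linarith
qed

section \<open>Edge sets with short chains\<close>

lemma ordered_graph_corner: "0 < t \<Longrightarrow> ordered_graph (n, corner t n)"
  by (auto simp: ordered_graph_def corner_def)

lemma ordered_graph_Un: "ordered_graph (n, E) \<Longrightarrow> ordered_graph (n, F) \<Longrightarrow> ordered_graph (n, E \<union> F)"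
  by (auto simp: ordered_graph_def)

lemma finite_edges: "ordered_graph (n, E) \<Longrightarrow> finite E"
  by (rule finite_subset[of _ "{..n} \<times> {..n}"]) (auto simp: ordered_graph_def)

lemma card_strict_chain_meeting_corner:
  assumes "strict_chain C" "C \<subseteq> {1..} \<times> {..n}" "C \<inter> corner (n - s) n \<noteq> {}" "s \<le> n"
  shows "card C \<le> s"
proof -
  obtain x y where xy: "(x, y) \<in> C" "x + (n - s) \<le> y" "y \<le> n"
    using assms(3) by (auto simp: corner_def)
  have "card C \<le> x + (n - y)"
    using assms(1) xy(1) assms(2) by (rule card_strict_chain_le)
  then show ?thesis
    using xy(2,3) assms(4) by linarith
qed

lemma card_le_of_longest_chain:
  assumes F: "ordered_graph (n, F)" "corner (n - s) n \<subseteq> F" and n: "2 * s \<le> n"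
    and cut: "\<And>p. longest_chain (subgrid F p p n) \<le> s"
    and total: "longest_chain F \<le> 2 * s"
  shows "card F \<le> s * n + (s choose 2)"
proof -
  let ?u = "wires F n"
  have "card F = card {e \<in> F. snd e \<le> n}"
    using F(1) by (intro arg_cong[where f = card]) (auto simp: ordered_graph_def)
  also have "\<dots> \<le> card (inversions n ?u)"
    using F(1) by (intro card_edges_le_card_inversions) (auto simp: ordered_graph_def)
  also have "\<dots> \<le> s * n + (s choose 2)"
  proof (rule card_inversions_le[OF bij_betw_wires])
    show "?u i = n - i" if "i < s" for i
      using wires_if_corner_subset[OF F(2), of i s] that n by simp
    show "card (exceeding ?u p) \<le> s" for p
    proof -
      have "exceeding ?u p = {i. p < ?u i} \<inter> {..<p}"
        by (auto simp: exceeding_def)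
      then show ?thesis
        using card_wires_above[of p p F n] cut[of p] by simp
    qed
    have "subgrid F n 0 n = F"
      using F(1) by (auto simp: subgrid_def ordered_graph_def)
    then show "card (inverted n ?u) \<le> 2 * s"
      using card_inverted_wires[of n F] total by simp
  qed (rule n)
  finally show ?thesis .
qed

lemma card_le_of_chain_bounds:
  assumes E: "ordered_graph (n, E)" and n: "2 * s \<le> n"
    and cut: "\<And>C p. C \<subseteq> E \<inter> {..p} \<times> {p<..} \<Longrightarrow> strict_chain C \<Longrightarrow> card C \<le> s"
    and total: "\<And>C. C \<subseteq> E \<Longrightarrow> strict_chain C \<Longrightarrow> card C \<le> 2 * s"
  shows "card E \<le> s * n + (s choose 2)"
proof (cases "n = 0")
  case True
  then have "E = {}"
    using E by (force simp: ordered_graph_def)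
  then show ?thesis
    by simp
next
  case False
  define F where "F = E \<union> corner (n - s) n"
  have F: "ordered_graph (n, F)"
    unfolding F_def using E n False by (intro ordered_graph_Un ordered_graph_corner) auto
  have corner: "card C \<le> s" if C: "C \<subseteq> F" "\<not> C \<subseteq> E" "strict_chain C" for C
  proof (rule card_strict_chain_meeting_corner[OF C(3)])
    show "C \<subseteq> {1..} \<times> {..n}"
      using C(1) F by (auto simp: ordered_graph_def)
    show "C \<inter> corner (n - s) n \<noteq> {}"
      using C(1,2) by (auto simp: F_def)
  qed (use n in simp)
  have "card F \<le> s * n + (s choose 2)"
  proof (rule card_le_of_longest_chain[OF F _ n])
    show "longest_chain (subgrid F p p n) \<le> s" for p
    proof (rule longest_chain_le[OF finite_subgrid])
      show "card C \<le> s" if "C \<subseteq> subgrid F p p n" "strict_chain C" for C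
        using that cut[of C p] corner[of C] by (cases "C \<subseteq> E") (auto simp: subgrid_def)
    qed
    show "longest_chain F \<le> 2 * s"
    proof (rule longest_chain_le[OF finite_edges[OF F]])
      show "card C \<le> 2 * s" if "C \<subseteq> F" "strict_chain C" for C
        using that total[of C] corner[of C] by (cases "C \<subseteq> E") auto
    qed
  qed (simp add: F_def)
  moreover have "card E \<le> card F"
    using finite_edges[OF F] by (rule card_mono) (simp add: F_def)
  ultimately show ?thesis
    by linarith
qed

section \<open>Non-nested matchings\<close>

lemma vertex_disjoint_imp_neq: "vertex_disjoint e f \<Longrightarrow> e \<noteq> f"
  by (auto simp: vertex_disjoint_def edge_verts_def)

lemma separated_iff:
  assumes "fst e < snd e" "fst f < snd f"
  shows "separated e f \<longleftrightarrow> snd e < fst f \<or> snd f < fst e"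
proof -
  have "edge_span e \<inter> edge_span f = {} \<longleftrightarrow> snd e < fst f \<or> snd f < fst e"
    using assms by (auto simp: edge_span_def disjoint_iff not_less)
  then show ?thesis
    using assms by (auto simp: separated_def vertex_disjoint_def edge_verts_def)
qed

lemma nested_iff:
  assumes "fst e < snd e" "fst f < snd f"
  shows "nested e f \<longleftrightarrow> fst e < fst f \<and> snd f < snd e \<or> fst f < fst e \<and> snd e < snd f"
  using assms by (auto simp: nested_def vertex_disjoint_def edge_verts_def edge_span_def)

lemma separated_imp_not_nested:
  assumes "separated e f" "fst e < snd e" "fst f < snd f"
  shows "\<not> nested e f"
  using assms by (auto simp: separated_iff nested_iff)

lemma crossing_if_common_cut:
  assumes "strictly_below e f \<or> strictly_below f e"
    and "fst e \<le> p" "p < snd e" "fst f \<le> p" "p < snd f"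
  shows "crossing e f"
proof -
  have "fst e < snd e" "fst f < snd f"
    using assms by auto
  then show ?thesis
    using assms
    by (auto simp: crossing_def separated_iff nested_iff vertex_disjoint_def edge_verts_def
      strictly_below_def)
qed

lemma matchingD:
  assumes "matching M"
  shows "finite M" "e \<in> M \<Longrightarrow> fst e < snd e"
    "e \<in> M \<Longrightarrow> f \<in> M \<Longrightarrow> e \<noteq> f \<Longrightarrow> vertex_disjoint e f"
  using assms by (auto simp: matching_def pairwise_def)

lemma matching_subset: "matching M \<Longrightarrow> N \<subseteq> M \<Longrightarrow> matching N"
  unfolding matching_def by (blast intro: finite_subset pairwise_subset)

lemma inj_on_fst_matching: "matching M \<Longrightarrow> inj_on fst M"
  by (force simp: inj_on_def vertex_disjoint_def edge_verts_def dest: matchingD(3))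

lemma card_matching_verts:
  assumes "matching M"
  shows "card (\<Union> (edge_verts ` M)) = 2 * card M"
proof -
  have "card (\<Union> (edge_verts ` M)) = (\<Sum>e\<in>M. card (edge_verts e))"
    using matchingD[OF assms]
    by (intro card_UN_disjoint) (auto simp: vertex_disjoint_def edge_verts_def)
  also have "\<dots> = (\<Sum>e\<in>M. 2)"
    using matchingD(2)[OF assms] by (intro sum.cong) (force simp: edge_verts_def card_insert_if)+
  finally show ?thesis
    by simp
qed

lemma non_nested_matching_mono:
  assumes "non_nested_matching M" "e \<in> M" "f \<in> M" "fst e \<le> fst f"
  shows "snd e \<le> snd f"
proof (cases "e = f")
  case False
  have M: "matching M"
    using assms(1) by (simp add: non_nested_matching_def)
  then have "vertex_disjoint e f" "fst e < snd e" "fst f < snd f"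
    using matchingD assms(2,3) False by blast+
  moreover have "\<not> nested e f"
    using assms False by (simp add: non_nested_matching_def pairwise_def)
  ultimately show ?thesis
    using assms(4) by (auto simp: nested_iff vertex_disjoint_def edge_verts_def)
qed simp

subsection \<open>Strongly non-nested matchings as labelled matchings\<close>

definition block_labelling :: "edge set \<Rightarrow> (edge \<Rightarrow> 'b) \<Rightarrow> bool" where
  "block_labelling M l \<longleftrightarrow> pairwise (\<lambda>e f. if l e = l f then crossing e f else separated e f) M"

lemma block_labellingD:
  assumes "block_labelling M l" "e \<in> M" "f \<in> M" "e \<noteq> f"
  shows "l e = l f \<Longrightarrow> crossing e f" "l e \<noteq> l f \<Longrightarrow> separated e f"
  using pairwiseD[OF assms(1)[unfolded block_labelling_def] assms(2-4)] by (simp_all split: if_splits)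

lemma strongly_non_nested_matchingI:
  assumes M: "matching M" and l: "block_labelling M l"
  shows "strongly_non_nested_matching M"
proof -
  define P where "P = (\<lambda>e. {f \<in> M. l f = l e}) ` M"
  have "partition_on M P"
    by (auto simp: partition_on_def disjoint_def P_def)
  moreover have "crossing_matching C" if "C \<in> P" for C
  proof -
    have C: "C \<subseteq> M" "\<And>e f. e \<in> C \<Longrightarrow> f \<in> C \<Longrightarrow> l e = l f"
      using that by (auto simp: P_def)
    have "pairwise crossing C"
      using C block_labellingD(1)[OF l] by (intro pairwiseI) blast
    then show ?thesis
      using matching_subset[OF M C(1)] by (simp add: crossing_matching_def)
  qed
  moreover have "pairwise (\<lambda>e f. crossing e f \<longleftrightarrow> (\<exists>C \<in> P. e \<in> C \<and> f \<in> C)) M"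
  proof (rule pairwiseI)
    fix e f
    assume ef: "e \<in> M" "f \<in> M" "e \<noteq> f"
    have "crossing e f \<longleftrightarrow> l e = l f"
      using block_labellingD[OF l ef] by (auto simp: crossing_def)
    also have "\<dots> \<longleftrightarrow> (\<exists>C \<in> P. e \<in> C \<and> f \<in> C)"
      using ef by (auto simp: P_def)
    finally show "crossing e f \<longleftrightarrow> (\<exists>C \<in> P. e \<in> C \<and> f \<in> C)" .
  qed
  moreover have "separated e f" if "C \<in> P" "D \<in> P" "C \<noteq> D" "e \<in> C" "f \<in> D" for C D e f
  proof -
    have "e \<in> M" "f \<in> M" "l e \<noteq> l f"
      using that by (auto simp: P_def)
    then show ?thesis
      using block_labellingD(2)[OF l] by metis
  qed
  ultimately show ?thesis
    unfolding strongly_non_nested_matching_def using M by blast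
qed

lemma strongly_non_nested_matchingE:
  assumes "strongly_non_nested_matching M"
  obtains l :: "edge \<Rightarrow> edge set" where "matching M" "block_labelling M l"
proof -
  obtain P where M: "matching M" and P: "partition_on M P" "\<forall>C \<in> P. crossing_matching C"
    "\<forall>C \<in> P. \<forall>D \<in> P. C \<noteq> D \<longrightarrow> (\<forall>e \<in> C. \<forall>f \<in> D. separated e f)"
    using assms unfolding strongly_non_nested_matching_def by blast
  have "\<forall>e \<in> M. \<exists>C. C \<in> P \<and> e \<in> C"
    using P(1) by (auto simp: partition_on_def)
  then obtain l where l: "\<And>e. e \<in> M \<Longrightarrow> l e \<in> P \<and> e \<in> l e"
    by metis
  have "block_labelling M l"
    unfolding block_labelling_def
  proof (rule pairwiseI)
    fix e f
    assume ef: "e \<in> M" "f \<in> M" "e \<noteq> f"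
    then have "crossing e f" if "l e = l f"
      using that l[of e] l[of f] P(2) by (auto simp: crossing_matching_def pairwise_def)
    moreover have "separated e f" if "l e \<noteq> l f"
      using that ef l P(3) by blast
    ultimately show "if l e = l f then crossing e f else separated e f"
      by simp
  qed
  then show thesis
    using that M by blast
qed

lemma strongly_non_nested_matching_imp_non_nested:
  assumes "strongly_non_nested_matching M"
  shows "non_nested_matching M"
proof -
  obtain l :: "edge \<Rightarrow> edge set" where M: "matching M" and l: "block_labelling M l"
    using assms by (rule strongly_non_nested_matchingE)
  have "\<not> nested e f" if ef: "e \<in> M" "f \<in> M" "e \<noteq> f" for e f
    using block_labellingD[OF l ef] separated_imp_not_nested matchingD(2)[OF M] ef
    by (cases "l e = l f") (simp_all add: crossing_def)
  then show ?thesis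
    using M by (simp add: non_nested_matching_def pairwise_def)
qed

lemma strongly_non_nested_matching_subset:
  assumes "strongly_non_nested_matching M" "N \<subseteq> M"
  shows "strongly_non_nested_matching N"
  using assms(1)
proof (rule strongly_non_nested_matchingE)
  fix l :: "edge \<Rightarrow> edge set"
  assume "matching M" "block_labelling M l"
  then have "matching N" "block_labelling N l"
    using assms(2) matching_subset pairwise_subset unfolding block_labelling_def by blast+
  then show ?thesis
    by (rule strongly_non_nested_matchingI)
qed

lemma crossing_matching_imp_strongly_non_nested:
  assumes "crossing_matching M"
  shows "strongly_non_nested_matching M"
  using assms
  by (intro strongly_non_nested_matchingI[where l = "\<lambda>_. ()"])
     (simp_all add: crossing_matching_def block_labelling_def)

lemma strongly_non_nested_matching_Un:
  assumes A: "crossing_matching A" and B: "strongly_non_nested_matching B"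
    and left: "\<And>e f. e \<in> A \<Longrightarrow> f \<in> B \<Longrightarrow> snd e < fst f"
  shows "strongly_non_nested_matching (A \<union> B)"
proof -
  obtain l :: "edge \<Rightarrow> edge set" where B_matching: "matching B" and l: "block_labelling B l"
    using B by (rule strongly_non_nested_matchingE)
  have A_matching: "matching A" and A_crossing: "pairwise crossing A"
    using A by (simp_all add: crossing_matching_def)
  define l' where "l' e = (if e \<in> A then None else Some (l e))" for e
  have fst_less_snd: "fst e < snd e" if "e \<in> A \<union> B" for e
    using that matchingD(2)[OF A_matching] matchingD(2)[OF B_matching] by blast
  have sep: "separated e f" "separated f e" if "e \<in> A" "f \<in> B" for e f
    using that left fst_less_snd by (simp_all add: separated_iff)
  then have "A \<inter> B = {}"
    unfolding separated_def using vertex_disjoint_imp_neq by blast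
  have l': "block_labelling (A \<union> B) l'"
    unfolding block_labelling_def
  proof (rule pairwiseI)
    fix e f
    assume "e \<in> A \<union> B" "f \<in> A \<union> B" and ef: "e \<noteq> f"
    then consider "e \<in> A" "f \<in> A" | "e \<in> A" "f \<in> B" | "e \<in> B" "f \<in> A" | "e \<in> B" "f \<in> B"
      by blast
    then show "if l' e = l' f then crossing e f else separated e f"
      using \<open>A \<inter> B = {}\<close> ef pairwiseD[OF A_crossing] sep block_labellingD[OF l]
      by cases (auto simp: l'_def)
  qed
  have "vertex_disjoint e f" if "e \<in> A \<union> B" "f \<in> A \<union> B" "e \<noteq> f" for e f
    using block_labellingD[OF l' that] by (cases "l' e = l' f") (auto simp: crossing_def separated_def)
  then have "matching (A \<union> B)"
    using matchingD(1)[OF A_matching] matchingD(1)[OF B_matching] fst_less_snd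
    by (auto simp: matching_def pairwise_def)
  then show ?thesis
    using l' by (rule strongly_non_nested_matchingI)
qed

subsection \<open>Strict chains as matchings\<close>

lemma crossing_matching_of_chain:
  assumes "finite C" "strict_chain C" "C \<subseteq> {..p} \<times> {p<..}"
  shows "crossing_matching C"
proof -
  have "pairwise crossing C"
    using assms(3)
    by (intro pairwiseI crossing_if_common_cut[OF strict_chainD[OF assms(2)], where p = p]) auto
  moreover from this have "matching C"
    using assms(1,3) by (auto simp: matching_def pairwise_def crossing_def)
  ultimately show ?thesis
    by (simp add: crossing_matching_def)
qed

lemma crossing_matching_first_block:
  assumes C: "finite C" "strict_chain C" and m: "0 < snd m" "\<And>c. c \<in> C \<Longrightarrow> snd m \<le> snd c"
  shows "crossing_matching {c \<in> C. fst c < snd m}"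
proof (rule crossing_matching_of_chain)
  show "{c \<in> C. fst c < snd m} \<subseteq> {..snd m - 1} \<times> {snd m - 1<..}"
    using m by force
qed (use C in \<open>auto intro: strict_chain_subset\<close>)

lemma strongly_non_nested_matching_first_block_Un:
  assumes C: "finite C" "strict_chain C" and m: "0 < snd m" "\<And>c. c \<in> C \<Longrightarrow> snd m \<le> snd c"
    and B: "strongly_non_nested_matching B"
    and gap: "B = {} \<or> (\<exists>d\<in>C. snd m \<le> fst d \<and> (\<forall>b\<in>B. snd d \<le> fst b))"
  shows "strongly_non_nested_matching ({c \<in> C. fst c < snd m} \<union> B)"
proof (rule strongly_non_nested_matching_Un[OF crossing_matching_first_block[OF C m] B])
  fix e b
  assume e: "e \<in> {c \<in> C. fst c < snd m}" and "b \<in> B"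
  then obtain d where d: "d \<in> C" "snd m \<le> fst d" "snd d \<le> fst b"
    using gap by blast
  then have "fst e < fst d"
    using e by simp
  then have "strictly_below e d"
    using strict_chainD[OF C(2), of e d] e d(1) by (auto simp: strictly_below_def)
  then show "snd e < fst b"
    using d(3) by (simp add: strictly_below_def)
qed

text \<open>
  Cut the chain greedily into crossing blocks: a block consists of all remaining edges starting before
  the first right end. Blocks at distance at least two are separated, so the blocks go alternately to
  the two matchings. The last conjunct is the gap that keeps the induction going.
\<close>

lemma strict_chain_split:
  assumes "finite C" "strict_chain C" "\<And>e. e \<in> C \<Longrightarrow> fst e < snd e"
  shows "\<exists>A B. C = A \<union> B \<and> strongly_non_nested_matching A \<and> strongly_non_nested_matching B
    \<and> (B = {} \<or> (\<exists>d\<in>C. \<forall>b\<in>B. snd d \<le> fst b))"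
  using assms
proof (induction C rule: finite_psubset_induct)
  case (psubset C)
  show ?case
  proof (cases "C = {}")
    case True
    moreover have "strongly_non_nested_matching {}"
      by (intro crossing_matching_imp_strongly_non_nested) (simp add: crossing_matching_def matching_def)
    ultimately show ?thesis
      by blast
  next
    case False
    then obtain m where m: "m \<in> C" "\<And>c. c \<in> C \<Longrightarrow> snd m \<le> snd c"
      using psubset.hyps ex_is_arg_min_if_finite[of C snd] by (metis is_arg_min_linorder)
    have "fst m < snd m"
      using psubset.prems(2) m(1) .
    define block where "block = {c \<in> C. fst c < snd m}"
    define rest where "rest = {c \<in> C. snd m \<le> fst c}"
    have "m \<in> C - rest"
      using m(1) \<open>fst m < snd m\<close> by (simp add: rest_def)
    then have C: "C = block \<union> rest" "rest \<subset> C"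
      by (auto simp: block_def rest_def)
    obtain A B where AB: "rest = A \<union> B" "strongly_non_nested_matching A" "strongly_non_nested_matching B"
      and gap: "B = {} \<or> (\<exists>d\<in>rest. \<forall>b\<in>B. snd d \<le> fst b)"
      using psubset.IH[OF C(2)] psubset.prems C strict_chain_subset by blast
    have "B = {} \<or> (\<exists>d\<in>C. snd m \<le> fst d \<and> (\<forall>b\<in>B. snd d \<le> fst b))"
      using gap unfolding rest_def by blast
    then have "strongly_non_nested_matching (block \<union> B)"
      unfolding block_def using psubset.hyps psubset.prems(1) m(2) \<open>fst m < snd m\<close> AB(3)
      by (intro strongly_non_nested_matching_first_block_Un) auto
    moreover have "\<forall>a\<in>A. snd m \<le> fst a"
      using AB(1) by (auto simp: rest_def)
    moreover have "C = (block \<union> B) \<union> A"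
      using C(1) AB(1) by auto
    ultimately show ?thesis
      using AB(2) m(1) by blast
  qed
qed

lemma card_le_of_strongly_non_nested_matchings:
  assumes E: "ordered_graph (n, E)" and n: "2 * s \<le> n"
    and small: "\<And>M. M \<subseteq> E \<Longrightarrow> strongly_non_nested_matching M \<Longrightarrow> card M \<le> s"
  shows "card E \<le> s * n + (s choose 2)"
proof (rule card_le_of_chain_bounds[OF E n])
  have fin: "finite C" if "C \<subseteq> E" for C
    using that finite_edges[OF E] by (rule finite_subset)
  show "card C \<le> s" if "C \<subseteq> E \<inter> {..p} \<times> {p<..}" "strict_chain C" for C p
    using that fin
    by (intro small crossing_matching_imp_strongly_non_nested crossing_matching_of_chain) auto
  show "card C \<le> 2 * s" if C: "C \<subseteq> E" "strict_chain C" for C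
  proof -
    have "fst e < snd e" if "e \<in> C" for e
      using that C(1) E by (auto simp: ordered_graph_def)
    then obtain A B where "C = A \<union> B" "strongly_non_nested_matching A" "strongly_non_nested_matching B"
      using strict_chain_split[OF fin[OF C(1)] C(2)] by blast
    then show ?thesis
      using card_Un_le[of A B] small[of A] small[of B] C(1) by simp
  qed
qed

section \<open>Copies of matchings\<close>

abbreviation relabel :: "(nat \<Rightarrow> nat) \<Rightarrow> edge \<Rightarrow> edge" where
  "relabel f \<equiv> map_prod f f"

lemma
  assumes f: "strict_mono_on A f" and e: "e \<in> A \<times> A" "e' \<in> A \<times> A"
  shows vertex_disjoint_relabel_iff: "vertex_disjoint (relabel f e) (relabel f e') \<longleftrightarrow> vertex_disjoint e e'"
    and separated_relabel_iff: "separated (relabel f e) (relabel f e') \<longleftrightarrow> separated e e'"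
    and nested_relabel_iff: "nested (relabel f e) (relabel f e') \<longleftrightarrow> nested e e'"
    and crossing_relabel_iff: "crossing (relabel f e) (relabel f e') \<longleftrightarrow> crossing e e'"
proof -
  obtain x y x' y' where [simp]: "e = (x, y)" "e' = (x', y')"
    by fastforce
  have [simp]: "f a = f b \<longleftrightarrow> a = b" "f a < f b \<longleftrightarrow> a < b" "f a \<le> f b \<longleftrightarrow> a \<le> b"
    if "a \<in> {x, y, x', y'}" "b \<in> {x, y, x', y'}" for a b
    using that e strict_mono_on_eq[OF f] strict_mono_on_less[OF f] strict_mono_on_less_eq[OF f] by auto
  show disjoint: "vertex_disjoint (relabel f e) (relabel f e') \<longleftrightarrow> vertex_disjoint e e'"
    by (simp add: vertex_disjoint_def edge_verts_def)
  have "{a..b} \<inter> {c..d} = {} \<longleftrightarrow> b < a \<or> d < c \<or> b < c \<or> d < a" for a b c d :: nat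
    by (auto simp: Int_atLeastAtMost)
  then show separated: "separated (relabel f e) (relabel f e') \<longleftrightarrow> separated e e'"
    unfolding separated_def disjoint by (simp add: edge_span_def)
  show nested: "nested (relabel f e) (relabel f e') \<longleftrightarrow> nested e e'"
    unfolding nested_def disjoint by (simp add: edge_span_def)
  show "crossing (relabel f e) (relabel f e') \<longleftrightarrow> crossing e e'"
    unfolding crossing_def disjoint separated nested ..
qed

lemma inj_on_relabel:
  assumes "strict_mono_on A f" "M \<subseteq> A \<times> A"
  shows "inj_on (relabel f) M"
  using map_prod_inj_on[of f A f A] strict_mono_on_imp_inj_on[OF assms(1)] assms(2)
  by (auto intro: inj_on_subset)

lemma matching_relabel_iff:
  assumes f: "strict_mono_on A f" and M: "M \<subseteq> A \<times> A"
  shows "matching (relabel f ` M) \<longleftrightarrow> matching M"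
proof -
  note inj = inj_on_relabel[OF f M]
  have "finite (relabel f ` M) \<longleftrightarrow> finite M"
    by (rule finite_image_iff[OF inj])
  moreover have "(\<forall>(x, y) \<in> relabel f ` M. x < y) \<longleftrightarrow> (\<forall>(x, y) \<in> M. x < y)"
    using M by (force simp: strict_mono_on_less[OF f])
  moreover have "vertex_disjoint (relabel f e) (relabel f e') \<longleftrightarrow> vertex_disjoint e e'"
    if "e \<in> M" "e' \<in> M" for e e'
    using that M by (intro vertex_disjoint_relabel_iff[OF f]) auto
  then have "pairwise vertex_disjoint (relabel f ` M) \<longleftrightarrow> pairwise vertex_disjoint M"
    by (simp add: pairwise_image pairwise_def inj_on_eq_iff[OF inj] cong: ball_cong_simp)
  ultimately show ?thesis
    by (simp add: matching_def)
qed

lemma non_nested_matching_relabel: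
  assumes f: "strict_mono_on A f" and M: "M \<subseteq> A \<times> A" "non_nested_matching M"
  shows "non_nested_matching (relabel f ` M)"
proof -
  have "\<not> nested (relabel f e) (relabel f e')" if "e \<in> M" "e' \<in> M" "e \<noteq> e'" for e e'
    using that M nested_relabel_iff[OF f, of e e'] by (auto simp: non_nested_matching_def pairwise_def)
  then have "pairwise (\<lambda>e f. \<not> nested e f) (relabel f ` M)"
    by (intro pairwise_imageI) auto
  then show ?thesis
    using M matching_relabel_iff[OF f M(1)] by (simp add: non_nested_matching_def)
qed

lemma strongly_non_nested_matching_relabelD:
  assumes f: "strict_mono_on A f" and M: "M \<subseteq> A \<times> A"
    and snn: "strongly_non_nested_matching (relabel f ` M)"
  shows "strongly_non_nested_matching M"
  using snn
proof (rule strongly_non_nested_matchingE)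
  fix l :: "edge \<Rightarrow> edge set"
  assume matching: "matching (relabel f ` M)" and l: "block_labelling (relabel f ` M) l"
  have "block_labelling M (l \<circ> relabel f)"
    unfolding block_labelling_def
  proof (rule pairwiseI)
    fix e e'
    assume e: "e \<in> M" "e' \<in> M" "e \<noteq> e'"
    then have "relabel f e \<noteq> relabel f e'"
      using inj_onD[OF inj_on_relabel[OF f M]] by blast
    then show "if (l \<circ> relabel f) e = (l \<circ> relabel f) e' then crossing e e' else separated e e'"
      using block_labellingD[OF l, of "relabel f e" "relabel f e'"] e M
        crossing_relabel_iff[OF f, of e e'] separated_relabel_iff[OF f, of e e']
      by auto
  qed
  then show ?thesis
    using matching matching_relabel_iff[OF f M] by (blast intro: strongly_non_nested_matchingI)
qed

lemma strict_mono_on_enumeration: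
  fixes V :: "nat set"
  assumes "finite V"
  obtains f where "strict_mono_on {1..card V} f" "f ` {1..card V} = V"
proof -
  obtain h where h: "bij_betw h {..<card V} V" "strict_mono_on {..<card V} h"
    using ex_bij_betw_strict_mono_card[OF assms] .
  have "strict_mono_on {1..card V} (\<lambda>i. h (i - 1))"
    by (auto intro!: strict_mono_onI strict_mono_onD[OF h(2)])
  moreover have "(\<lambda>i. h (i - 1)) ` {1..card V} = h ` {..<card V}"
    unfolding image_Suc_lessThan[symmetric] image_image by simp
  ultimately show thesis
    using that bij_betw_imp_surj_on[OF h(1)] by simp
qed

lemma non_nested_submatching_of_copy:
  assumes "H \<in> non_nested_family k" "contains_copy (n, E) H"
  obtains M where "M \<subseteq> E" "card M = k" "non_nested_matching M"
proof -
  obtain M where H: "H = (2 * k, M)" and M: "ordered_graph (2 * k, M)" "card M = k" "non_nested_matching M"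
    using assms(1) by (auto simp: non_nested_family_def)
  obtain f where f: "strict_mono_on {1..2 * k} f" "\<forall>(x, y) \<in> M. (f x, f y) \<in> E"
    using assms(2) by (auto simp: contains_copy_def H)
  have sub: "M \<subseteq> {1..2 * k} \<times> {1..2 * k}"
    using M(1) by (auto simp: ordered_graph_def)
  show thesis
  proof (rule that)
    show "relabel f ` M \<subseteq> E"
      using f(2) by auto
    show "card (relabel f ` M) = k"
      using card_image[OF inj_on_relabel[OF f(1) sub]] M(2) by simp
    show "non_nested_matching (relabel f ` M)"
      using f(1) sub M(3) by (rule non_nested_matching_relabel)
  qed
qed

lemma copy_of_strongly_non_nested_submatching:
  assumes E: "ordered_graph (n, E)" and M: "M \<subseteq> E" "strongly_non_nested_matching M"
  obtains H where "H \<in> strongly_non_nested_family (card M)" "contains_copy (n, E) H"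
proof -
  have matching: "matching M"
    using M(2) by (rule strongly_non_nested_matchingE)
  define V where "V = \<Union> (edge_verts ` M)"
  have V: "card V = 2 * card M" "finite V" "M \<subseteq> V \<times> V" "V \<subseteq> {1..n}"
    using card_matching_verts[OF matching] matchingD(1)[OF matching] M(1) E
    by (force simp: V_def edge_verts_def ordered_graph_def)+
  obtain f where f: "strict_mono_on {1..2 * card M} f" "f ` {1..2 * card M} = V"
    using strict_mono_on_enumeration[OF V(2)] unfolding V(1) .
  have "M \<subseteq> relabel f ` ({1..2 * card M} \<times> {1..2 * card M})"
    using V(3) map_prod_surj_on[OF f(2) f(2)] by simp
  then obtain N where N: "N \<subseteq> {1..2 * card M} \<times> {1..2 * card M}" "M = relabel f ` N"
    by (rule subset_imageE)
  have N_snn: "strongly_non_nested_matching N"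
    using strongly_non_nested_matching_relabelD[OF f(1) N(1)] M(2) N(2) by simp
  then have "matching N"
    by (rule strongly_non_nested_matchingE)
  then have "ordered_graph (2 * card M, N)"
    using N(1) by (force simp: ordered_graph_def dest: matchingD(2))
  moreover have "card N = card M"
    unfolding N(2) by (rule card_image[OF inj_on_relabel[OF f(1) N(1)], symmetric])
  ultimately have "(2 * card M, N) \<in> strongly_non_nested_family (card M)"
    using N_snn by (simp add: strongly_non_nested_family_def)
  moreover have "contains_copy (n, E) (2 * card M, N)"
    using f V(4) M(1) N(2) by (force simp: contains_copy_def)
  ultimately show thesis
    by (rule that)
qed

lemma strongly_non_nested_family_subset: "strongly_non_nested_family k \<subseteq> non_nested_family k"
  using strongly_non_nested_matching_imp_non_nested
  by (auto simp: strongly_non_nested_family_def non_nested_family_def)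

lemma non_nested_family_nonempty_edges:
  assumes "1 \<le> k" "H \<in> non_nested_family k"
  shows "snd H \<noteq> {}"
  using assms by (auto simp: non_nested_family_def)

section \<open>The extremal function\<close>

definition avoids :: "ograph \<Rightarrow> ograph set \<Rightarrow> bool" where
  "avoids G \<H> \<longleftrightarrow> (\<forall>H\<in>\<H>. \<not> contains_copy G H)"

lemma finite_edge_counts: "finite {card E |E. ordered_graph (n, E) \<and> Q E}"
proof (rule finite_subset)
  show "{card E |E. ordered_graph (n, E) \<and> Q E} \<subseteq> card ` {E. E \<subseteq> {..n} \<times> {..n} \<and> Q E}"
    by (force simp: ordered_graph_def)
qed (simp add: finite_subset_cards)

lemma card_le_ex_ord: "ordered_graph (n, E) \<Longrightarrow> avoids (n, E) \<H> \<Longrightarrow> card E \<le> ex_ord n \<H>"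
  unfolding ex_ord_def avoids_def by (intro Max_ge[OF finite_edge_counts]) blast

lemma ex_ord_le:
  assumes "\<And>H. H \<in> \<H> \<Longrightarrow> snd H \<noteq> {}"
    and "\<And>E. ordered_graph (n, E) \<Longrightarrow> avoids (n, E) \<H> \<Longrightarrow> card E \<le> b"
  shows "ex_ord n \<H> \<le> b"
  unfolding ex_ord_def
proof (rule Max.boundedI[OF finite_edge_counts])
  have "ordered_graph (n, {}) \<and> (\<forall>H\<in>\<H>. \<not> contains_copy (n, {}) H)"
    using assms(1) by (force simp: ordered_graph_def contains_copy_def)
  then show "{card E |E. ordered_graph (n, E) \<and> (\<forall>H\<in>\<H>. \<not> contains_copy (n, E) H)} \<noteq> {}"
    by blast
qed (use assms(2) in \<open>auto simp: avoids_def\<close>)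

lemma ex_ord_antimono:
  assumes "\<G> \<subseteq> \<H>" "\<And>H. H \<in> \<H> \<Longrightarrow> snd H \<noteq> {}"
  shows "ex_ord n \<H> \<le> ex_ord n \<G>"
  using assms by (intro ex_ord_le card_le_ex_ord) (auto simp: avoids_def)

subsection \<open>The upper bound\<close>

lemma card_strongly_non_nested_matching_less:
  assumes E: "ordered_graph (n, E)" "avoids (n, E) (strongly_non_nested_family k)"
    and M: "M \<subseteq> E" "strongly_non_nested_matching M"
  shows "card M < k"
proof (rule ccontr)
  assume "\<not> card M < k"
  then obtain N where N: "N \<subseteq> M" "card N = k"
    using obtain_subset_with_card_n[of k M] by auto
  have "N \<subseteq> E" "strongly_non_nested_matching N"
    using N(1) M strongly_non_nested_matching_subset by auto
  then show False
    using copy_of_strongly_non_nested_submatching[OF E(1), of N] E(2) N(2) unfolding avoids_def by metis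
qed

lemma ex_ord_strongly_non_nested_family_le:
  assumes "1 \<le> k" "2 * k \<le> n"
  shows "ex_ord n (strongly_non_nested_family k) \<le> (k - 1) * n + ((k - 1) choose 2)"
proof (rule ex_ord_le)
  show "snd H \<noteq> {}" if "H \<in> strongly_non_nested_family k" for H
    using that strongly_non_nested_family_subset non_nested_family_nonempty_edges[OF assms(1)] by blast
  show "card E \<le> (k - 1) * n + ((k - 1) choose 2)"
    if E: "ordered_graph (n, E)" "avoids (n, E) (strongly_non_nested_family k)" for E
  proof (rule card_le_of_strongly_non_nested_matchings[OF E(1)])
    show "card M \<le> k - 1" if "M \<subseteq> E" "strongly_non_nested_matching M" for M
      using card_strongly_non_nested_matching_less[OF E that] by simp
  qed (use assms(2) in simp)
qed

subsection \<open>The lower bound\<close>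

definition hub_graph :: "nat \<Rightarrow> nat \<Rightarrow> edge set" where
  "hub_graph n k = {(x, y). 1 \<le> x \<and> x < y \<and> y \<le> n \<and> (x < k \<or> y < 2 * k)}"

lemma ordered_graph_hub_graph: "ordered_graph (n, hub_graph n k)"
  by (auto simp: ordered_graph_def hub_graph_def)

lemma card_hub_graph:
  assumes "2 * k \<le> n"
  shows "(k - 1) * n \<le> card (hub_graph n k)"
proof -
  \<comment> \<open>Pairs \<open>(i, y)\<close> with \<open>y \<le> i\<close> go to the edges of the clique on \<open>{k..<2 * k}\<close>.\<close>
  define g where "g = (\<lambda>(i, y). if i < y then (i, y) else (y + k - 1, i + k :: nat))"
  have "card ({1..<k} \<times> {1..n}) \<le> card (hub_graph n k)"
  proof (rule card_inj_on_le)
    show "inj_on g ({1..<k} \<times> {1..n})"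
      by (auto simp: inj_on_def g_def split: if_splits)
    show "g ` ({1..<k} \<times> {1..n}) \<subseteq> hub_graph n k"
      using assms by (auto simp: g_def hub_graph_def split: if_splits)
  qed (rule finite_edges[OF ordered_graph_hub_graph])
  then show ?thesis
    by (simp add: card_cartesian_product)
qed

lemma card_non_nested_matching_hub_graph_less:
  assumes "1 \<le> k" "M \<subseteq> hub_graph n k" "non_nested_matching M"
  shows "card M < k"
proof (rule ccontr)
  assume large: "\<not> card M < k"
  have M: "matching M"
    using assms(3) by (simp add: non_nested_matching_def)
  have "M \<noteq> {}"
    using large assms(1) by auto
  then have "Max (fst ` M) \<in> fst ` M"
    using matchingD(1)[OF M] by (intro Max_in) auto
  then obtain e where "e \<in> M" "fst e = Max (fst ` M)"
    by auto
  then have e: "e \<in> M" "\<And>f. f \<in> M \<Longrightarrow> fst f \<le> fst e"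
    using matchingD(1)[OF M] by simp_all
  then have snd_le: "snd f \<le> snd e" if "f \<in> M" for f
    using non_nested_matching_mono[OF assms(3)] that by blast
  have "card M = card (fst ` M)"
    using card_image[OF inj_on_fst_matching[OF M]] by simp
  also have "\<dots> \<le> card {1..fst e}"
    using assms(2) e(2) by (intro card_mono) (auto simp: hub_graph_def)
  finally have "snd e < 2 * k"
    using large assms(2) e(1) by (auto simp: hub_graph_def)
  have "\<Union> (edge_verts ` M) \<subseteq> {1..snd e}"
    using assms(2) snd_le by (force simp: edge_verts_def hub_graph_def)
  then have "card (\<Union> (edge_verts ` M)) \<le> card {1..snd e}"
    by (intro card_mono) auto
  then show False
    using card_matching_verts[OF M] large \<open>snd e < 2 * k\<close> by simp
qed

lemma avoids_hub_graph:
  assumes "1 \<le> k"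
  shows "avoids (n, hub_graph n k) (non_nested_family k)"
  unfolding avoids_def
  using non_nested_submatching_of_copy card_non_nested_matching_hub_graph_less[OF assms]
  by (metis less_irrefl)

theorem theorem2p2:
  fixes n k :: nat
  assumes "1 \<le> k" and "2 * k \<le> n"
  shows "(k - 1) * n \<le> ex_ord n (non_nested_family k)
    \<and> ex_ord n (non_nested_family k) \<le> ex_ord n (strongly_non_nested_family k)
    \<and> ex_ord n (strongly_non_nested_family k) \<le> (k - 1) * n + ((k - 1) choose 2)"
proof (intro conjI)
  have "(k - 1) * n \<le> card (hub_graph n k)"
    using assms(2) by (rule card_hub_graph)
  also have "\<dots> \<le> ex_ord n (non_nested_family k)"
    using ordered_graph_hub_graph avoids_hub_graph[OF assms(1)] by (rule card_le_ex_ord)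
  finally show "(k - 1) * n \<le> ex_ord n (non_nested_family k)" .
  show "ex_ord n (non_nested_family k) \<le> ex_ord n (strongly_non_nested_family k)"
    using strongly_non_nested_family_subset non_nested_family_nonempty_edges[OF assms(1)]
    by (rule ex_ord_antimono)
  show "ex_ord n (strongly_non_nested_family k) \<le> (k - 1) * n + ((k - 1) choose 2)"
    using assms by (rule ex_ord_strongly_non_nested_family_le)
qed

end
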